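(* Let $\omega$ be a weight. The following statements are equivalent. (1) ($\omega\in\bigcup_{q>1}RH_q$) There exist $C,q>1$ such that for all $n\in\mathbb{N}$, $\mathbb{E}(\omega^q|\mathcal{F}_n)\le C\,\mathbb{E}(\omega|\mathcal{F}_n)^q$. (2) ($\omega\in A_\infty^{CF}$) There exist $0<\varepsilon'<1$ and $C>1$ such that for all $n\in\mathbb{N}$ and $A\in\mathcal{F}$, $\mathbb{E}_\omega(\chi_A|\mathcal{F}_n)\le C\,\mathbb{E}(\chi_A|\mathcal{F}_n)^{\varepsilon'}$.
   Context: $(\Omega,\mathcal{F},\mu)$ is a complete probability space and $(\mathcal{F}_n)_{n\ge0}$ is an increasing sequence of sub-$\sigma$-fields of $\mathcal{F}$ with $\mathcal{F}=\bigvee_{n\ge0}\mathcal{F}_n$. $\mathbb{N}$ is the set of non-negative integers. $\mathbb{E}(\cdot|\mathcal{F}_n)$ is conditional expectation with respect to $\mu$ (of nonnegative functions it may take the value $+\infty$). Relations between random variables hold almost surely. A weight $\omega$ is a random variable with $\omega>0$ and $\mathbb{E}(\omega)<\infty$; $\omega_n:=\mathbb{E}(\omega|\mathcal{F}_n)$. $\mathbb{E}_\omega(\cdot|\mathcal{F}_n)$ is the conditional expectation with respect to $\omega\,d\mu$, i.e. $\mathbb{E}_\omega(f|\mathcal{F}_n)=\mathbb{E}(f\omega|\mathcal{F}_n)/\omega_n$. $\chi_A$ is the indicator function of $A$. *)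

theory Defs
  imports "HOL-Probability.Probability"
begin

text \<open>Positivity is required almost surely only; finite expectation is integrability of \<open>w\<close>.\<close>

definition weight :: "'a measure \<Rightarrow> ('a \<Rightarrow> real) \<Rightarrow> bool" where
  "weight M w \<longleftrightarrow> integrable M w \<and> (AE x in M. 0 < w x)"

definition weighted_cond_exp ::
    "'a measure \<Rightarrow> ('a \<Rightarrow> real) \<Rightarrow> 'a measure \<Rightarrow> ('a \<Rightarrow> real) \<Rightarrow> 'a \<Rightarrow> real" where
  "weighted_cond_exp M w G f = real_cond_exp (density M (\<lambda>x. ennreal (w x))) G f"

text \<open>A weight may be nonpositive on a null set, so the truncation by \<^const>\<open>ennreal\<close> in the
  density is harmless. The quotient formula for the conditional expectation with respect to
  \<open>w dM\<close> is proved here, first for nonnegative and then for real functions.\<close>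

lemma nn_cond_exp_density:
  assumes "prob_space M" "subalgebra M G" "weight M w" and f[measurable]: "f \<in> borel_measurable M"
  shows "AE x in M. nn_cond_exp (density M (\<lambda>x. ennreal (w x))) G f x
    = nn_cond_exp M G (\<lambda>x. f x * ennreal (w x)) x / nn_cond_exp M G (\<lambda>x. ennreal (w x)) x"
    and "AE x in M. 0 < nn_cond_exp M G (\<lambda>x. ennreal (w x)) x"
    and "AE x in M. nn_cond_exp M G (\<lambda>x. ennreal (w x)) x < \<infinity>"
proof -
  let ?w = "\<lambda>x. ennreal (w x)"
  let ?D = "density M ?w"
  let ?W = "nn_cond_exp M G ?w"
  let ?N = "nn_cond_exp M G (\<lambda>x. f x * ?w x)"
  interpret M: prob_space M by fact
  interpret finite_measure_subalgebra M G
    by unfold_locales fact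
  have wi: "integrable M w" and wp: "AE x in M. 0 < w x"
    using assms(3) by (auto simp: weight_def)
  have [measurable]: "w \<in> borel_measurable M" using wi by auto
  have fin: "(\<integral>\<^sup>+x. ?w x \<partial>M) < \<infinity>"
    using wi wp by (subst nn_integral_eq_integral) (auto elim: eventually_mono)
  have MG: "A \<in> sets M" if "A \<in> sets G" for A
    using that assms(2) by (auto simp: subalgebra_def)
  have spG: "space G = space M"
    using assms(2) by (auto simp: subalgebra_def)
  have subD: "subalgebra ?D G" using assms(2) by (auto simp: subalgebra_def)
  have "finite_measure ?D"
    using fin by (intro finite_measureI) (simp add: emeasure_density cong: nn_integral_cong)
  then interpret D: finite_measure_subalgebra ?D G
    by (intro finite_measure_subalgebra.intro finite_measure_subalgebra_axioms.intro subD)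
  have Wint: "(\<integral>\<^sup>+x. ?W x \<partial>M) < \<infinity>"
    using nn_cond_exp_intg[of "\<lambda>_. 1" ?w] fin by simp
  show Wfin: "AE x in M. ?W x < \<infinity>"
    using nn_integral_PInf_AE[of ?W M] Wint
    by (auto simp: less_top elim: eventually_mono)
  define Z where "Z = {x \<in> space G. ?W x = 0}"
  have Z[measurable]: "Z \<in> sets G" unfolding Z_def by measurable
  have [measurable]: "Z \<in> sets M" using MG Z by blast
  have "(\<integral>\<^sup>+x. indicator Z x * ?w x \<partial>M) = (\<integral>\<^sup>+x. indicator Z x * ?W x \<partial>M)"
    by (rule nn_cond_exp_intg[symmetric]) auto
  also have "\<dots> = (\<integral>\<^sup>+x. 0 \<partial>M)"
    by (intro nn_integral_cong) (auto simp: Z_def indicator_def)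
  finally have "(\<integral>\<^sup>+x. indicator Z x * ?w x \<partial>M) = 0" by simp
  then have "AE x in M. indicator Z x * ?w x = 0"
    using nn_integral_0_iff_AE[of "\<lambda>x. indicator Z x * ?w x" M] by simp
  with wp AE_space show Wpos: "AE x in M. 0 < ?W x"
  proof eventually_elim
    case (elim x)
    then show ?case
      by (cases "?W x = 0") (auto simp: Z_def spG indicator_def zero_less_iff_neq_zero)
  qed
  have "AE x in ?D. ?N x / ?W x = nn_cond_exp ?D G f x"
  proof (rule D.nn_cond_exp_charact)
    fix A assume A[measurable]: "A \<in> sets G"
    have [measurable]: "A \<in> sets M" using MG A by blast
    have "(\<integral>\<^sup>+x\<in>A. (?N x / ?W x) \<partial>?D) = (\<integral>\<^sup>+x. (?N x / ?W x * indicator A x) * ?w x \<partial>M)"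
      by (subst nn_integral_density) (auto intro!: nn_integral_cong simp: mult_ac)
    also have "\<dots> = (\<integral>\<^sup>+x. (?N x / ?W x * indicator A x) * ?W x \<partial>M)"
      by (rule nn_cond_exp_intg[symmetric]) auto
    also have "\<dots> = (\<integral>\<^sup>+x. indicator A x * ?N x \<partial>M)"
    proof (rule nn_integral_cong_AE)
      show "AE x in M. (?N x / ?W x * indicator A x) * ?W x = indicator A x * ?N x"
        using Wpos Wfin
      proof eventually_elim
        case (elim x)
        have "?N x / ?W x * ?W x = ?N x"
          using elim by (metis ennreal_divide_times divide_ennreal_def ennreal_mult_divide_eq
              ennreal_times_divide infinity_ennreal_def less_irrefl mult.commute)
        then show ?case by (simp add: indicator_def)
      qed
    qed
    also have "\<dots> = (\<integral>\<^sup>+x. indicator A x * (f x * ?w x) \<partial>M)"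
      by (rule nn_cond_exp_intg) auto
    also have "\<dots> = (\<integral>\<^sup>+x\<in>A. f x \<partial>?D)"
      by (subst nn_integral_density) (auto intro!: nn_integral_cong simp: mult_ac)
    finally show "(\<integral>\<^sup>+x\<in>A. f x \<partial>?D) = (\<integral>\<^sup>+x\<in>A. (?N x / ?W x) \<partial>?D)" by simp
  qed auto
  then have "AE x in M. 0 < ?w x \<longrightarrow> ?N x / ?W x = nn_cond_exp ?D G f x"
    by (subst (asm) AE_density) auto
  with wp show "AE x in M. nn_cond_exp ?D G f x = ?N x / ?W x"
    by eventually_elim auto
qed

lemma weighted_cond_exp_eq:
  assumes "prob_space M" "subalgebra M G" "weight M w" and f[measurable]: "f \<in> borel_measurable M"
  shows "AE x in M. weighted_cond_exp M w G f x
    = real_cond_exp M G (\<lambda>x. f x * w x) x / real_cond_exp M G w x"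
proof -
  interpret M: prob_space M by fact
  interpret finite_measure_subalgebra M G
    by unfold_locales fact
  have wp: "AE x in M. 0 < w x" and [measurable]: "w \<in> borel_measurable M"
    using assms(3) by (auto simp: weight_def)
  note nn = nn_cond_exp_density[OF assms(1-3)]
  have c: "AE x in M. nn_cond_exp M G (\<lambda>x. ennreal (g x) * ennreal (w x)) x
      = nn_cond_exp M G (\<lambda>x. ennreal (g x * w x)) x" if [measurable]: "g \<in> borel_measurable M" for g
    by (rule nn_cond_exp_cong) (use wp in \<open>auto simp: ennreal_mult'' elim!: eventually_mono\<close>)
  have z: "AE x in M. nn_cond_exp M G (\<lambda>x. ennreal (- w x)) x = nn_cond_exp M G (\<lambda>x. 0) x"
    by (rule nn_cond_exp_cong) (use wp in \<open>auto simp: ennreal_neg elim!: eventually_mono\<close>)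
  have z0: "AE x in M. 0 = nn_cond_exp M G (\<lambda>x. 0) x"
    by (rule nn_cond_exp_F_meas) auto
  have e: "enn2real (a / b) = enn2real a / enn2real b" if "0 < b" "b < \<infinity>" for a b :: ennreal
    using that
    by (cases a; cases b) (auto simp: divide_ennreal ennreal_top_divide)
  have m: "(\<lambda>x. ennreal (f x)) \<in> borel_measurable M" "(\<lambda>x. ennreal (- f x)) \<in> borel_measurable M"
    by auto
  have mf: "(\<lambda>x. - f x) \<in> borel_measurable M" by auto
  show ?thesis
    unfolding weighted_cond_exp_def real_cond_exp_def
    using nn(1)[OF m(1)] nn(1)[OF m(2)] nn(2,3)[OF m(1)] c[OF f] c[OF mf] z z0
    by eventually_elim (auto simp: e diff_divide_distrib)
qed

end

theory Submission
  imports Defs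
begin

text \<open>Both implications are statements about a single \<open>\<sigma>\<close>-field \<open>G\<close>: the constants that come out
  depend on the constants that go in, and so they are uniform along the filtration. Write
  \<open>W = E(w|G)\<close>, \<open>p = E(\<chi>\<^sub>A|G)\<close>, and \<open>E\<^sub>w\<close> for conditional expectation with respect to \<open>w dM\<close>.

  From reverse Hoelder to the comparison: truncating the weight at a level \<open>l > 0\<close> gives
  \<open>w \<chi>\<^sub>A \<le> l \<chi>\<^sub>A + l\<^bsup>1-q\<^esup> w\<^bsup>q\<^esup>\<close>. Conditioning bounds \<open>W E\<^sub>w(\<chi>\<^sub>A|G)\<close> by
  \<open>l p + l\<^bsup>1-q\<^esup> C W\<^bsup>q\<^esup>\<close>, and the level \<open>l = W p\<^bsup>-1/q\<^esup>\<close>, which balances the two terms, yields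
  the exponent \<open>1 - 1/q\<close>. This takes the place of the conditional Hoelder inequality, and
  needs only constant levels
  (\<open>le_add_powr_truncation\<close>, \<open>optimise_truncation_level\<close>, \<open>reverse_Hoelder_imp_comparison\<close>).

  From the comparison to reverse Hoelder: test the hypothesis on the superlevel sets
  \<open>A\<^sub>k = {2\<^sup>k W < w}\<close>, which lie in the big \<open>\<sigma>\<close>-field but in general not in \<open>G\<close>. On \<open>A\<^sub>k\<close> the
  weight is large, so \<open>2\<^sup>k p\<^sub>k \<le> E\<^sub>w(\<chi>|G) \<le> C p\<^sub>k\<^bsup>e\<^esup>\<close> with \<open>\<chi>\<close> the indicator of \<open>A\<^sub>k\<close>. Since
  \<open>e < 1\<close>, this forces \<open>p\<^sub>k\<close>, and then \<open>E\<^sub>w(\<chi>|G)\<close>, to decay geometrically, the latter like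
  \<open>2\<^bsup>-kd\<^esup>\<close> with \<open>d = e/(1-e)\<close> (\<open>comparison_imp_superlevel_decay\<close>). Cutting \<open>w\<close> into the dyadic
  layers \<open>2\<^sup>k W < w \<le> 2\<^bsup>k+1\<^esup> W\<close> bounds \<open>E(w\<^bsup>1+s\<^esup>|G)\<close> by \<open>W\<^bsup>1+s\<^esup>\<close> times a series with terms
  of order \<open>2\<^bsup>k(s-d)\<^esup>\<close>, which converges for \<open>s = d/2\<close>
  (\<open>powr_le_dyadic_sum\<close>, \<open>comparison_imp_reverse_Hoelder\<close>).\<close>

section \<open>Conditional expectations of nonnegative functions\<close>

lemma (in sigma_finite_subalgebra) nn_cond_exp_suminf:
  fixes f :: "nat \<Rightarrow> 'a \<Rightarrow> ennreal"
  assumes [measurable]: "\<And>k. f k \<in> borel_measurable M"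
  shows "AE x in M. (\<Sum>k. nn_cond_exp M F (f k) x) = nn_cond_exp M F (\<lambda>x. \<Sum>k. f k x) x"
proof (rule nn_cond_exp_charact)
  fix A assume A[measurable]: "A \<in> sets F"
  have [measurable]: "A \<in> sets M"
    using A subalg by (auto simp: subalgebra_def)
  have swap: "(\<integral>\<^sup>+x\<in>A. (\<Sum>k. g k x) \<partial>M) = (\<Sum>k. \<integral>\<^sup>+x. indicator A x * g k x \<partial>M)"
    if [measurable]: "\<And>k. g k \<in> borel_measurable M" for g :: "nat \<Rightarrow> 'a \<Rightarrow> ennreal"
    by (subst nn_integral_suminf[symmetric])
      (auto intro!: nn_integral_cong simp: mult.commute)
  show "(\<integral>\<^sup>+x\<in>A. (\<Sum>k. f k x) \<partial>M) = (\<integral>\<^sup>+x\<in>A. (\<Sum>k. nn_cond_exp M F (f k) x) \<partial>M)"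
    by (simp add: swap nn_cond_exp_intg)
qed auto

text \<open>Powers of the weight need not be integrable, so estimates are made for the extended
  nonnegative conditional expectation; this lemma translates the integrable terms back.\<close>

lemma (in sigma_finite_subalgebra) nn_cond_exp_ennreal:
  fixes f :: "'a \<Rightarrow> real"
  assumes int: "integrable M f" and nn: "AE x in M. 0 \<le> f x"
  shows "AE x in M. nn_cond_exp M F (\<lambda>x. ennreal (f x)) x = ennreal (real_cond_exp M F f x)
    \<and> 0 \<le> real_cond_exp M F f x"
proof -
  let ?P = "nn_cond_exp M F (\<lambda>x. ennreal (f x))"
  have [measurable]: "f \<in> borel_measurable M"
    using int by auto
  have "(\<integral>\<^sup>+x. ?P x \<partial>M) = (\<integral>\<^sup>+x. ennreal (f x) \<partial>M)"
    using nn_cond_exp_intg[of "\<lambda>_. 1" "\<lambda>x. ennreal (f x)"] by simp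
  also have "\<dots> < \<infinity>"
    using int nn by (subst nn_integral_eq_integral) auto
  finally have fin: "AE x in M. ?P x \<noteq> \<infinity>"
    by (intro nn_integral_PInf_AE) auto
  have neg: "AE x in M. nn_cond_exp M F (\<lambda>x. ennreal (- f x)) x = nn_cond_exp M F (\<lambda>x. 0) x"
    by (rule nn_cond_exp_cong) (use nn in \<open>auto simp: ennreal_neg elim!: eventually_mono\<close>)
  have zero: "AE x in M. 0 = nn_cond_exp M F (\<lambda>x. 0) x"
    by (rule nn_cond_exp_F_meas) auto
  show ?thesis
    using fin neg zero
    by eventually_elim (auto simp: real_cond_exp_def ennreal_enn2real_if)
qed

section \<open>Elementary inequalities\<close>

text \<open>If \<open>a\<close> exceeds the level \<open>l\<close>, then the last term is \<open>a (a/l)\<^bsup>q-1\<^esup> \<ge> a\<close>.\<close>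

lemma le_add_powr_truncation:
  fixes a l q :: real
  assumes "0 < a" "0 < l" "1 < q"
  shows "a \<le> l + l powr (1 - q) * a powr q"
proof (cases "a \<le> l")
  case True
  have "0 \<le> l powr (1 - q) * a powr q" by simp
  with True show ?thesis by linarith
next
  case False
  have "l powr (q - 1) \<le> a powr (q - 1)"
    using False assms by (intro powr_mono2) auto
  then have "a * l powr (q - 1) \<le> a powr q"
    using assms by (simp add: powr_diff field_simps)
  then have "a \<le> l powr (1 - q) * a powr q"
    using assms by (simp add: powr_diff field_simps)
  with assms show ?thesis by linarith
qed

text \<open>The level \<open>W p\<^bsup>-1/q\<^esup>\<close> makes both terms multiples of \<open>W p\<^bsup>1-1/q\<^esup>\<close>. The bound is assumed for
  rational levels only, because in the application it holds almost surely for each level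
  separately and only countably many exceptional sets can be discarded together. Overshooting the
  optimal level by a factor less than \<open>2\<close> doubles the first term at most and does not increase the
  second one, whence the constant \<open>2 + K\<close>.\<close>

lemma optimise_truncation_level:
  fixes N p K W q :: real
  assumes p: "0 \<le> p" and K: "0 \<le> K" and W: "0 < W" and q: "1 < q"
    and bound: "\<And>l. l \<in> \<rat> \<Longrightarrow> 0 < l \<Longrightarrow> N \<le> l * p + l powr (1 - q) * (K * W powr q)"
  shows "N \<le> (2 + K) * W * p powr (1 - 1 / q)"
proof (cases "p = 0")
  case True
  \<comment> \<open>The optimal level is infinite here: the bound vanishes as the level grows.\<close>
  have "(\<lambda>n. real (Suc n) powr (1 - q) * (K * W powr q)) \<longlonglongrightarrow> 0 * (K * W powr q)"
    using q by (intro tendsto_mult tendsto_const tendsto_neg_powr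
        filterlim_compose[OF filterlim_real_sequentially filterlim_Suc]) auto
  moreover have "N \<le> real (Suc n) powr (1 - q) * (K * W powr q)" for n
    using bound[of "real (Suc n)"] True by auto
  ultimately have "N \<le> 0"
    by (intro LIMSEQ_le_const[where X="\<lambda>n. real (Suc n) powr (1 - q) * (K * W powr q)"]) auto
  then show ?thesis using True by simp
next
  case False
  with p have p: "0 < p" by simp
  define l where "l = W * p powr (- 1 / q)"
  have l: "0 < l" using W p by (simp add: l_def)
  then obtain l' where l': "l' \<in> \<rat>" "l < l'" "l' < 2 * l"
    using Rats_dense_in_real[of l "2 * l"] by auto
  have "l' powr (1 - q) \<le> l powr (1 - q)"
    using l l' q by (intro powr_mono2') auto
  then have "l' powr (1 - q) * (K * W powr q) \<le> l powr (1 - q) * (K * W powr q)"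
    using K by (intro mult_right_mono) auto
  moreover have "l' * p \<le> 2 * l * p"
    using l' p by simp
  moreover have "N \<le> l' * p + l' powr (1 - q) * (K * W powr q)"
    using bound l' l by simp
  ultimately have "N \<le> 2 * (l * p) + K * (l powr (1 - q) * W powr q)"
    by (simp add: mult_ac)
  moreover have "l * p = W * p powr (1 - 1 / q)"
  proof -
    have "p powr (- 1 / q) * p powr 1 = p powr (1 - 1 / q)"
      by (simp only: powr_add[symmetric]) simp
    then show ?thesis using p by (simp add: l_def)
  qed
  moreover have "l powr (1 - q) * W powr q = W * p powr (1 - 1 / q)"
  proof -
    have "W powr (1 - q) * W powr q = W"
      using W by (simp add: powr_add[symmetric])
    moreover have "(- 1 / q) * (1 - q) = 1 - 1 / q"
      using q by (simp add: field_simps)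
    ultimately show ?thesis
      using W p by (simp add: l_def powr_mult powr_powr mult_ac)
  qed
  ultimately show ?thesis by (simp add: algebra_simps)
qed

text \<open>As \<open>e < 1\<close>, the hypothesis can be solved for \<open>p\<close>: it gives \<open>p\<^bsup>1-e\<^esup> \<le> C/t\<close>.\<close>

lemma self_improving_decay:
  fixes p t C e :: real
  assumes p: "0 \<le> p" and t: "0 < t" and C: "0 < C" and e: "0 < e" "e < 1"
    and le: "t * p \<le> C * p powr e"
  shows "C * p powr e \<le> C * (C / t) powr (e / (1 - e))"
proof (cases "p = 0")
  case False
  with p have p: "0 < p" by simp
  have "p powr (1 - e) \<le> C / t"
    using le p t by (simp add: powr_diff field_simps)
  then have "(p powr (1 - e)) powr (e / (1 - e)) \<le> (C / t) powr (e / (1 - e))"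
    using e by (intro powr_mono2) auto
  then have "p powr e \<le> (C / t) powr (e / (1 - e))"
    using e by (simp add: powr_powr)
  then show ?thesis using C by simp
qed (use C e in simp)

lemma dyadic_layer:
  fixes r :: real
  assumes "1 < r"
  obtains k where "2 ^ k < r" "r \<le> 2 ^ Suc k"
proof -
  define k where "k = (LEAST k. r \<le> 2 ^ Suc k)"
  obtain n where "r < 2 ^ n"
    using real_arch_pow[of 2 r] by auto
  moreover have "(2::real) ^ n \<le> 2 ^ Suc n" by simp
  ultimately have "r \<le> 2 ^ Suc n" by linarith
  then have le: "r \<le> 2 ^ Suc k"
    unfolding k_def by (rule LeastI)
  have "2 ^ k < r"
  proof (cases k)
    case (Suc j)
    then have "\<not> r \<le> 2 ^ Suc j"
      using not_less_Least[of j "\<lambda>k. r \<le> 2 ^ Suc k"] by (simp add: k_def)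
    then show ?thesis using Suc by simp
  qed (use assms in simp)
  with le that show thesis by blast
qed

text \<open>The first term covers \<open>a \<le> W\<close>; otherwise \<open>a\<close> lies in one dyadic layer
  \<open>2\<^sup>k W < a \<le> 2\<^bsup>k+1\<^esup> W\<close>, and the term of that layer alone suffices. The summands use the
  superlevel sets \<open>2\<^sup>k W < a\<close> instead of the layers since these are the sets whose conditional
  measure is estimated below.\<close>

lemma powr_le_dyadic_sum:
  fixes a W s :: real
  assumes a: "0 < a" and W: "0 < W" and s: "0 < s"
  shows "ennreal (a powr (1 + s)) \<le> ennreal (W powr s) * ennreal a
    + (\<Sum>k. ennreal ((2 ^ Suc k * W) powr s) * (if 2 ^ k * W < a then ennreal a else 0))"
    (is "_ \<le> _ + suminf ?g")
proof -
  have split: "ennreal (a powr (1 + s)) \<le> ennreal (c powr s) * ennreal a" if "a \<le> c" for c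
  proof -
    have "a powr s * a \<le> c powr s * a"
      using that a s by (intro mult_right_mono powr_mono2) auto
    then show ?thesis
      using a by (simp add: powr_add ennreal_mult'[symmetric] mult.commute)
  qed
  show ?thesis
  proof (cases "a \<le> W")
    case True
    then show ?thesis using split[of W] by (auto intro: order_trans)
  next
    case False
    then have "1 < a / W" using W by simp
    then obtain k where "2 ^ k < a / W" "a / W \<le> 2 ^ Suc k"
      by (rule dyadic_layer)
    then have "2 ^ k * W < a" "a \<le> 2 ^ Suc k * W"
      using W by (simp_all add: field_simps)
    then have "ennreal (a powr (1 + s)) \<le> ?g k"
      using split by simp
    also have "\<dots> \<le> suminf ?g"
      using sum_le_suminf[of ?g "{k}"] by simp
    finally show ?thesis by (simp add: add_increasing)
  qed
qed

section \<open>Conditional expectations of a weight\<close>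

lemma weight_real_cond_exp:
  assumes "prob_space M" "subalgebra M G" "weight M w"
  shows "AE x in M. 0 < real_cond_exp M G w x"
    and "AE x in M. nn_cond_exp M G (\<lambda>x. ennreal (w x)) x = ennreal (real_cond_exp M G w x)"
proof -
  interpret prob_space M by fact
  interpret finite_measure_subalgebra M G by unfold_locales fact
  have w: "integrable M w" "AE x in M. 0 < w x"
    using assms(3) by (auto simp: weight_def)
  then show "AE x in M. 0 < real_cond_exp M G w x"
    by (intro real_cond_exp_gr_c)
  have "AE x in M. 0 \<le> w x"
    using w(2) by eventually_elim simp
  from nn_cond_exp_ennreal[OF w(1) this]
  show "AE x in M. nn_cond_exp M G (\<lambda>x. ennreal (w x)) x = ennreal (real_cond_exp M G w x)"
    by eventually_elim simp
qed

lemma weight_set_cond_exp: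
  assumes "prob_space M" "subalgebra M G" "weight M w" and A[measurable]: "A \<in> sets M"
  shows "AE x in M. 0 \<le> real_cond_exp M G (indicator A) x"
    and "AE x in M. nn_cond_exp M G (indicator A) x = ennreal (real_cond_exp M G (indicator A) x)"
    and "AE x in M. nn_cond_exp M G (\<lambda>x. indicator A x * ennreal (w x)) x
      = ennreal (real_cond_exp M G w x * weighted_cond_exp M w G (indicator A) x)"
    and "AE x in M. 0 \<le> weighted_cond_exp M w G (indicator A) x"
proof -
  interpret prob_space M by fact
  interpret finite_measure_subalgebra M G by unfold_locales fact
  have w: "integrable M w" "AE x in M. 0 < w x"
    using assms(3) by (auto simp: weight_def)
  have "integrable M (indicator A :: 'a \<Rightarrow> real)"
    by (simp add: less_top[symmetric])
  from nn_cond_exp_ennreal[OF this]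
  show "AE x in M. 0 \<le> real_cond_exp M G (indicator A) x"
    and "AE x in M. nn_cond_exp M G (indicator A) x = ennreal (real_cond_exp M G (indicator A) x)"
    by (auto simp: ennreal_indicator elim: eventually_mono)
  have "integrable M (\<lambda>x. indicator A x * w x)"
    using integrable_mult_indicator[OF A w(1)] by simp
  moreover have "AE x in M. 0 \<le> indicator A x * w x"
    using w(2) by eventually_elim simp
  ultimately have N: "AE x in M. nn_cond_exp M G (\<lambda>x. ennreal (indicator A x * w x)) x
      = ennreal (real_cond_exp M G (\<lambda>x. indicator A x * w x) x)
      \<and> 0 \<le> real_cond_exp M G (\<lambda>x. indicator A x * w x) x"
    by (rule nn_cond_exp_ennreal)
  have eq: "ennreal (indicator A x * w x) = indicator A x * ennreal (w x)" for x
    by (simp add: indicator_def)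
  note Wpos = weight_real_cond_exp(1)[OF assms(1-3)]
  note quot = weighted_cond_exp_eq[OF assms(1-3), of "indicator A", OF borel_measurable_indicator[OF A]]
  show "AE x in M. nn_cond_exp M G (\<lambda>x. indicator A x * ennreal (w x)) x
      = ennreal (real_cond_exp M G w x * weighted_cond_exp M w G (indicator A) x)"
    using N Wpos quot by eventually_elim (simp add: eq)
  show "AE x in M. 0 \<le> weighted_cond_exp M w G (indicator A) x"
    using N Wpos quot by eventually_elim simp
qed

section \<open>Reverse Hoelder implies the comparison of conditional measures\<close>

lemma reverse_Hoelder_imp_comparison:
  assumes "prob_space M" "subalgebra M G" "weight M w" and A[measurable]: "A \<in> sets M"
    and q: "1 < q" and K: "0 \<le> K"
    and RH: "AE x in M. nn_cond_exp M G (\<lambda>y. ennreal (w y powr q)) x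
      \<le> ennreal (K * real_cond_exp M G w x powr q)"
  shows "AE x in M. weighted_cond_exp M w G (indicator A) x
    \<le> (2 + K) * real_cond_exp M G (indicator A) x powr (1 - 1 / q)"
proof -
  let ?W = "real_cond_exp M G w" and ?P = "real_cond_exp M G (indicator A)"
  let ?E = "weighted_cond_exp M w G (indicator A)"
  interpret prob_space M by fact
  interpret finite_measure_subalgebra M G by unfold_locales fact
  have [measurable]: "w \<in> borel_measurable M" and w: "AE x in M. 0 < w x"
    using assms(3) by (auto simp: weight_def)
  note set = weight_set_cond_exp[OF assms(1-3) A]
  note Wpos = weight_real_cond_exp(1)[OF assms(1-3)]
  \<comment> \<open>Conditioning the truncation inequality at a constant level.\<close>
  have level: "AE x in M. ?W x * ?E x \<le> l * ?P x + l powr (1 - q) * (K * ?W x powr q)"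
    if l: "0 < l" for l
  proof -
    let ?a = "\<lambda>x. ennreal l * indicator A x"
    let ?b = "\<lambda>x. ennreal (l powr (1 - q)) * ennreal (w x powr q)"
    have "AE x in M. indicator A x * ennreal (w x) \<le> ?a x + ?b x"
      using w
    proof eventually_elim
      case (elim x)
      have "ennreal (w x) \<le> ennreal (l + l powr (1 - q) * w x powr q)"
        using le_add_powr_truncation[OF elim l q] by (rule ennreal_leI)
      also have "\<dots> = ennreal l + ?b x"
        using l by (subst ennreal_plus) (simp_all add: ennreal_mult)
      finally show ?case by (auto simp: indicator_def)
    qed
    then have "AE x in M. nn_cond_exp M G (\<lambda>x. indicator A x * ennreal (w x)) x
        \<le> nn_cond_exp M G (\<lambda>x. ?a x + ?b x) x"
      by (rule nn_cond_exp_mono) auto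
    moreover have "AE x in M. nn_cond_exp M G ?a x + nn_cond_exp M G ?b x
        = nn_cond_exp M G (\<lambda>x. ?a x + ?b x) x"
      by (rule nn_cond_exp_sum) auto
    moreover have "AE x in M. ennreal l * nn_cond_exp M G (indicator A) x = nn_cond_exp M G ?a x"
      by (rule nn_cond_exp_prod) auto
    moreover have "AE x in M. ennreal (l powr (1 - q)) * nn_cond_exp M G (\<lambda>x. ennreal (w x powr q)) x
        = nn_cond_exp M G ?b x"
      by (rule nn_cond_exp_prod) auto
    ultimately show ?thesis
      using set(1-3) RH
    proof eventually_elim
      case (elim x)
      have "ennreal (?W x * ?E x) \<le> ennreal l * ennreal (?P x)
          + ennreal (l powr (1 - q)) * nn_cond_exp M G (\<lambda>x. ennreal (w x powr q)) x"
        using elim by simp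
      also have "\<dots> \<le> ennreal l * ennreal (?P x)
          + ennreal (l powr (1 - q)) * ennreal (K * ?W x powr q)"
        using elim by (intro add_left_mono mult_left_mono) auto
      also have "\<dots> = ennreal (l * ?P x + l powr (1 - q) * (K * ?W x powr q))"
        using \<open>0 \<le> ?P x\<close> l K by (subst ennreal_plus) (simp_all add: ennreal_mult)
      finally show ?case
        using elim l K by (subst (asm) ennreal_le_iff) auto
    qed
  qed
  have "AE x in M. \<forall>l\<in>\<rat>. 0 < l \<longrightarrow> ?W x * ?E x \<le> l * ?P x + l powr (1 - q) * (K * ?W x powr q)"
    using level by (auto simp: AE_ball_countable[OF countable_rat])
  with set(1) Wpos show ?thesis
  proof eventually_elim
    case (elim x)
    have "?W x * ?E x \<le> (2 + K) * ?W x * ?P x powr (1 - 1 / q)"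
      using elim by (intro optimise_truncation_level[OF _ K _ q]) auto
    then show ?case using elim by (simp add: mult_ac)
  qed
qed

section \<open>The comparison of conditional measures implies reverse Hoelder\<close>

text \<open>With \<open>P = E(\<chi>\<^sub>A|G)\<close>, the inequality \<open>t W \<chi>\<^sub>A \<le> w \<chi>\<^sub>A\<close> conditions to
  \<open>t P \<le> E\<^sub>w(\<chi>\<^sub>A|G)\<close>, because \<open>W\<close> is \<open>G\<close>-measurable; together with the comparison this is the
  hypothesis of \<open>self_improving_decay\<close>.\<close>

lemma comparison_imp_superlevel_decay:
  assumes "prob_space M" "subalgebra M G" "weight M w"
    and e: "0 < e" "e < 1" and C: "0 < C" and t: "0 < t"
    and A_def: "A = {x \<in> space M. t * real_cond_exp M G w x < w x}"
    and comparison: "AE x in M. weighted_cond_exp M w G (indicator A) x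
      \<le> C * real_cond_exp M G (indicator A) x powr e"
  shows "AE x in M. nn_cond_exp M G (\<lambda>x. indicator A x * ennreal (w x)) x
    \<le> ennreal (real_cond_exp M G w x * (C * (C / t) powr (e / (1 - e))))"
proof -
  let ?W = "real_cond_exp M G w" and ?P = "real_cond_exp M G (indicator A)"
  let ?E = "weighted_cond_exp M w G (indicator A)"
  interpret prob_space M by fact
  interpret finite_measure_subalgebra M G by unfold_locales fact
  have [measurable]: "w \<in> borel_measurable M"
    using assms(3) by (auto simp: weight_def)
  have A[measurable]: "A \<in> sets M" unfolding A_def by measurable
  note set = weight_set_cond_exp[OF assms(1-3) A]
  note Wpos = weight_real_cond_exp(1)[OF assms(1-3)]
  have "AE x in M. nn_cond_exp M G (\<lambda>x. ennreal (t * ?W x) * indicator A x) x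
      \<le> nn_cond_exp M G (\<lambda>x. indicator A x * ennreal (w x)) x"
    by (rule nn_cond_exp_mono)
      (auto intro!: AE_I2 ennreal_leI simp: A_def indicator_def)
  moreover have "AE x in M. ennreal (t * ?W x) * nn_cond_exp M G (indicator A) x
      = nn_cond_exp M G (\<lambda>x. ennreal (t * ?W x) * indicator A x) x"
    by (rule nn_cond_exp_prod) auto
  ultimately show ?thesis
    using set Wpos comparison
  proof eventually_elim
    case (elim x)
    have "ennreal (t * ?W x * ?P x) \<le> ennreal (?W x * ?E x)"
      using elim t by (simp add: ennreal_mult')
    then have "?W x * (t * ?P x) \<le> ?W x * ?E x"
      using elim by (subst (asm) ennreal_le_iff) (auto simp: mult_ac)
    then have "t * ?P x \<le> C * ?P x powr e"
      using elim by simp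
    then have "C * ?P x powr e \<le> C * (C / t) powr (e / (1 - e))"
      using elim by (intro self_improving_decay[OF _ t C e]) auto
    then have "?E x \<le> C * (C / t) powr (e / (1 - e))"
      using elim by simp
    then show ?case
      using elim by (auto intro!: ennreal_leI)
  qed
qed

text \<open>The reverse Hoelder inequality would follow in the same way for every exponent \<open>1 + s\<close> with
  \<open>0 < s < d\<close>; half of the critical value is taken for definiteness. The constant is one, from the
  part \<open>w \<le> W\<close>, plus the sum of the geometric series of the layers, whose ratio is
  \<open>2\<^bsup>s-d\<^esup> = 2\<^bsup>-d/2\<^esup>\<close>.\<close>

lemma comparison_imp_reverse_Hoelder:
  assumes "prob_space M" "subalgebra M G" "weight M w"
    and e: "0 < e" "e < 1" and C: "0 < C" and d_def: "d = e / (1 - e)"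
    and comparison: "\<And>A. A \<in> sets M \<Longrightarrow> AE x in M. weighted_cond_exp M w G (indicator A) x
      \<le> C * real_cond_exp M G (indicator A) x powr e"
  shows "AE x in M. nn_cond_exp M G (\<lambda>y. ennreal (w y powr (1 + d / 2))) x
    \<le> ennreal ((1 + C powr (1 + d) * 2 powr (d / 2) / (1 - 2 powr (- d / 2)))
        * real_cond_exp M G w x powr (1 + d / 2))"
proof -
  let ?W = "real_cond_exp M G w"
  define s where "s = d / 2"
  define D where "D = C powr (1 + d) * 2 powr s"
  define r where "r = (2::real) powr (- s)"
  define A where "A k = {x \<in> space M. 2 ^ k * ?W x < w x}" for k :: nat
  interpret prob_space M by fact
  interpret finite_measure_subalgebra M G by unfold_locales fact
  have [measurable]: "w \<in> borel_measurable M" and w: "AE x in M. 0 < w x"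
    using assms(3) by (auto simp: weight_def)
  have A[measurable]: "A k \<in> sets M" for k unfolding A_def by measurable
  have s: "0 < s" using e by (simp add: s_def d_def)
  have D: "0 < D" using C by (simp add: D_def)
  have r: "0 < r" "r < 1" using s by (simp_all add: r_def powr_less_one)
  note W = weight_real_cond_exp[OF assms(1-3)]
  let ?h = "\<lambda>k x. indicator (A k) x * ennreal (w x)"
  let ?f = "\<lambda>x. ennreal (?W x powr s) * ennreal (w x)"
  let ?g = "\<lambda>k x. ennreal ((2 ^ Suc k * ?W x) powr s) * ?h k x"
  have decay: "AE x in M. nn_cond_exp M G (?h k) x
      \<le> ennreal (?W x * (C * (C / 2 ^ k) powr d))" for k
    unfolding d_def
    by (rule comparison_imp_superlevel_decay[OF assms(1-3) e C _ A_def comparison[OF A]]) simp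
  have "AE x in M. nn_cond_exp M G (\<lambda>y. ennreal (w y powr (1 + s))) x
      \<le> nn_cond_exp M G (\<lambda>x. ?f x + (\<Sum>k. ?g k x)) x"
  proof (rule nn_cond_exp_mono)
    show "AE x in M. ennreal (w x powr (1 + s)) \<le> ?f x + (\<Sum>k. ?g k x)"
      using w W(1) AE_space
    proof eventually_elim
      case (elim x)
      then have "?h k x = (if 2 ^ k * ?W x < w x then ennreal (w x) else 0)" for k
        by (simp add: A_def)
      then show ?case
        using powr_le_dyadic_sum[of "w x" "?W x" s] elim s by simp
    qed
  qed auto
  moreover have "AE x in M. nn_cond_exp M G ?f x + nn_cond_exp M G (\<lambda>x. \<Sum>k. ?g k x) x
      = nn_cond_exp M G (\<lambda>x. ?f x + (\<Sum>k. ?g k x)) x"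
    by (rule nn_cond_exp_sum) auto
  moreover have "AE x in M. (\<Sum>k. nn_cond_exp M G (?g k) x) = nn_cond_exp M G (\<lambda>x. \<Sum>k. ?g k x) x"
    by (rule nn_cond_exp_suminf) auto
  moreover have "AE x in M. ennreal (?W x powr s) * nn_cond_exp M G (\<lambda>x. ennreal (w x)) x
      = nn_cond_exp M G ?f x"
    by (rule nn_cond_exp_prod) auto
  moreover have "AE x in M. \<forall>k. ennreal ((2 ^ Suc k * ?W x) powr s) * nn_cond_exp M G (?h k) x
      = nn_cond_exp M G (?g k) x"
    unfolding AE_all_countable by (intro allI nn_cond_exp_prod) auto
  moreover have "AE x in M. \<forall>k. nn_cond_exp M G (?h k) x \<le> ennreal (?W x * (C * (C / 2 ^ k) powr d))"
    unfolding AE_all_countable using decay by blast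
  ultimately have "AE x in M. nn_cond_exp M G (\<lambda>y. ennreal (w y powr (1 + s))) x
      \<le> ennreal ((1 + D / (1 - r)) * ?W x powr (1 + s))"
    using W
  proof eventually_elim
    case (elim x)
    let ?V = "?W x powr (1 + s)"
    have V: "?W x powr s * ?W x = ?V"
      using elim by (simp add: powr_add)
    \<comment> \<open>The factor \<open>2\<^bsup>(k+1)s\<^esup>\<close> of the layer against the decay \<open>2\<^bsup>-2ks\<^esup>\<close>, as \<open>d = 2s\<close>.\<close>
    have layer: "nn_cond_exp M G (?g k) x \<le> ennreal (?V * D * r ^ k)" for k
    proof -
      have pow: "(2::real) ^ n = 2 powr real n" for n
        by (simp add: powr_realpow)
      have rk: "r ^ k = 2 powr (- s * real k)"
        by (simp add: r_def powr_powr powr_realpow[symmetric])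
      have "(2 ^ Suc k * ?W x) powr s * (?W x * (C * (C / 2 ^ k) powr d))
          = (2 powr (real (Suc k) * s) * ?W x powr s)
            * (?W x * (C * (C powr d * 2 powr (- (real k * d)))))"
        using elim C
        by (simp add: pow powr_mult powr_divide powr_powr powr_minus_divide del: power_Suc of_nat_Suc)
      also have "\<dots> = ?V * C powr (1 + d) * (2 powr (real (Suc k) * s) * 2 powr (- (real k * d)))"
        using C elim by (simp add: V[symmetric] powr_add)
      also have "2 powr (real (Suc k) * s) * 2 powr (- (real k * d)) = 2 powr s * r ^ k"
      proof -
        have "d = 2 * s" by (simp add: s_def)
        then have "real (Suc k) * s + - (real k * d) = s + - s * real k"
          by (simp add: algebra_simps)
        then show ?thesis by (simp only: rk powr_add[symmetric])
      qed
      also have "?V * C powr (1 + d) * (2 powr s * r ^ k) = ?V * D * r ^ k"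
        by (simp add: D_def)
      finally have eq: "(2 ^ Suc k * ?W x) powr s * (?W x * (C * (C / 2 ^ k) powr d)) = ?V * D * r ^ k" .
      have "nn_cond_exp M G (?g k) x = ennreal ((2 ^ Suc k * ?W x) powr s) * nn_cond_exp M G (?h k) x"
        by (rule elim(5)[rule_format, symmetric])
      also have "\<dots> \<le> ennreal ((2 ^ Suc k * ?W x) powr s) * ennreal (?W x * (C * (C / 2 ^ k) powr d))"
        by (rule mult_left_mono[OF elim(6)[rule_format]]) simp
      also have "\<dots> = ennreal (?V * D * r ^ k)"
        by (subst ennreal_mult'[symmetric]) (simp_all only: eq powr_ge_zero)
      finally show ?thesis .
    qed
    have sums: "(\<lambda>k. ?V * D * r ^ k) sums (?V * D * (1 / (1 - r)))"
      using r by (intro sums_mult geometric_sums) auto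
    have "nn_cond_exp M G (\<lambda>y. ennreal (w y powr (1 + s))) x
        \<le> ennreal ?V + (\<Sum>k. nn_cond_exp M G (?g k) x)"
    proof -
      have "ennreal (?W x powr s) * nn_cond_exp M G (\<lambda>x. ennreal (w x)) x = ennreal ?V"
        unfolding elim(8) by (subst ennreal_mult'[symmetric]) (simp_all only: V powr_ge_zero)
      then show ?thesis
        using elim(1) unfolding elim(2)[symmetric] elim(3)[symmetric] elim(4)[symmetric] by (simp only:)
    qed
    also have "\<dots> \<le> ennreal ?V + (\<Sum>k. ennreal (?V * D * r ^ k))"
      by (intro add_left_mono suminf_le layer) auto
    also have "(\<Sum>k. ennreal (?V * D * r ^ k)) = ennreal (?V * D * (1 / (1 - r)))"
      using sums D r by (subst suminf_ennreal2) (auto simp: sums_iff)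
    also have "ennreal ?V + \<dots> = ennreal ((1 + D / (1 - r)) * ?V)"
      using D r by (subst ennreal_plus[symmetric]) (auto simp: algebra_simps)
    finally show ?case .
  qed
  then show ?thesis by (simp add: s_def D_def r_def)
qed

section \<open>The equivalence\<close>

theorem theorem1p3:
  fixes M :: "'a measure" and F :: "nat \<Rightarrow> 'a measure" and w :: "'a \<Rightarrow> real"
  assumes "prob_space M" and "complete_measure M"
    and "filtration (space M) F" and "\<And>n. subalgebra M (F n)"
    and "sets M = sigma_sets (space M) (\<Union>n. sets (F n))"
    and "weight M w"
  shows "(\<exists>C q :: real. C > 1 \<and> q > 1 \<and>
            (\<forall>n. AE x in M. nn_cond_exp M (F n) (\<lambda>y. ennreal (w y powr q)) x
                  \<le> ennreal (C * real_cond_exp M (F n) w x powr q)))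
     \<longleftrightarrow> (\<exists>\<epsilon> C :: real. 0 < \<epsilon> \<and> \<epsilon> < 1 \<and> C > 1 \<and>
            (\<forall>n. \<forall>A \<in> sets M. AE x in M. weighted_cond_exp M w (F n) (indicator A) x
                  \<le> C * real_cond_exp M (F n) (indicator A) x powr \<epsilon>))"
    (is "?RH \<longleftrightarrow> ?CF")
proof
  assume ?RH
  then obtain C q where C: "1 < C" and q: "1 < q"
    and RH: "\<And>n. AE x in M. nn_cond_exp M (F n) (\<lambda>y. ennreal (w y powr q)) x
        \<le> ennreal (C * real_cond_exp M (F n) w x powr q)"
    by blast
  have "AE x in M. weighted_cond_exp M w (F n) (indicator A) x
      \<le> (2 + C) * real_cond_exp M (F n) (indicator A) x powr (1 - 1 / q)"
    if "A \<in> sets M" for n A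
    using C by (intro reverse_Hoelder_imp_comparison[OF assms(1,4,6) that q _ RH]) auto
  moreover have "0 < 1 - 1 / q" "1 - 1 / q < 1" "1 < 2 + C"
    using C q by (auto simp: field_simps)
  ultimately show ?CF by blast
next
  assume ?CF
  then obtain e C where e: "0 < e" "e < 1" and C: "1 < C"
    and comparison: "\<And>n A. A \<in> sets M \<Longrightarrow> AE x in M. weighted_cond_exp M w (F n) (indicator A) x
        \<le> C * real_cond_exp M (F n) (indicator A) x powr e"
    by blast
  define d where "d = e / (1 - e)"
  define K where "K = 1 + C powr (1 + d) * 2 powr (d / 2) / (1 - 2 powr (- d / 2))"
  have d: "0 < d" using e by (simp add: d_def)
  then have "(2::real) powr (- d / 2) < 1"
    by (simp add: powr_less_one)
  then have "1 < K" using C by (simp add: K_def)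
  moreover have "AE x in M. nn_cond_exp M (F n) (\<lambda>y. ennreal (w y powr (1 + d / 2))) x
      \<le> ennreal (K * real_cond_exp M (F n) w x powr (1 + d / 2))" for n
    unfolding K_def using C
    by (intro comparison_imp_reverse_Hoelder[OF assms(1,4,6) e _ d_def comparison]) auto
  moreover have "1 < 1 + d / 2" using d by simp
  ultimately show ?RH by blast
qed

end
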